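(* For every alphabet $\Sigma$, every right-angled Artin group defined by a finite or countably infinite simple graph embeds as a subgroup of $\llbracket\Sigma^{\mathbb{Z}}\rrbracket$.
   Context: An alphabet is a finite set with at least two elements. For the full shift $\Sigma^{\mathbb{Z}}$ with shift $\sigma(x)_i=x_{i+1}$, $\llbracket\Sigma^{\mathbb{Z}}\rrbracket$ is the group of all homeomorphisms $f:\Sigma^{\mathbb{Z}}\to\Sigma^{\mathbb{Z}}$ for which there is a continuous $c:\Sigma^{\mathbb{Z}}\to\mathbb{Z}$ with $f(x)=\sigma^{c(x)}(x)$ for all $x$. The right-angled Artin group of a graph $(V,E)$ is $\langle V\mid uv=vu \text{ for } \{u,v\}\in E\rangle$. *)

theory Defs
  imports "HOL-Analysis.Analysis" "HOL-Algebra.Group"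
begin

definition shift_space :: "(int \<Rightarrow> 'a) topology" where
  "shift_space = product_topology (\<lambda>_. discrete_topology UNIV) UNIV"

definition shift_pow :: "int \<Rightarrow> (int \<Rightarrow> 'a) \<Rightarrow> (int \<Rightarrow> 'a)" where
  "shift_pow n x = (\<lambda>i. x (i + n))"

definition tfg_carrier :: "((int \<Rightarrow> 'a) \<Rightarrow> (int \<Rightarrow> 'a)) set" where
  "tfg_carrier = {f. homeomorphic_map shift_space shift_space f \<and>
      (\<exists>c :: (int \<Rightarrow> 'a) \<Rightarrow> int. continuous_map shift_space (discrete_topology UNIV) c \<and>
          (\<forall>x. f x = shift_pow (c x) x))}"

definition topological_full_group :: "((int \<Rightarrow> 'a) \<Rightarrow> (int \<Rightarrow> 'a)) monoid" where
  "topological_full_group = \<lparr>carrier = tfg_carrier, mult = (\<circ>), one = id\<rparr>"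

definition simple_graph :: "'v set \<Rightarrow> 'v set set \<Rightarrow> bool" where
  "simple_graph V E \<longleftrightarrow> (\<forall>e\<in>E. \<exists>u v. e = {u, v} \<and> u \<noteq> v \<and> u \<in> V \<and> v \<in> V)"

text \<open>Words: lists of letters (v, b); (v, True) stands for v, (v, False) for v^-1.
  One-step relation: free cancellation of v v^-1 / v^-1 v, and commutation of adjacent
  letters whose vertices are joined by an edge.\<close>
inductive raag_step :: "'v set \<Rightarrow> 'v set set \<Rightarrow> ('v \<times> bool) list \<Rightarrow> ('v \<times> bool) list \<Rightarrow> bool"
  for V E where
  cancel: "v \<in> V \<Longrightarrow> raag_step V E (xs @ [(v, b), (v, \<not> b)] @ ys) (xs @ ys)"
| commute: "{u, v} \<in> E \<Longrightarrow> raag_step V E (xs @ [(u, a), (v, b)] @ ys) (xs @ [(v, b), (u, a)] @ ys)"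

definition raag_eq :: "'v set \<Rightarrow> 'v set set \<Rightarrow> ('v \<times> bool) list \<Rightarrow> ('v \<times> bool) list \<Rightarrow> bool" where
  "raag_eq V E = equivclp (raag_step V E)"

definition raag_class :: "'v set \<Rightarrow> 'v set set \<Rightarrow> ('v \<times> bool) list \<Rightarrow> ('v \<times> bool) list set" where
  "raag_class V E w = {w'. raag_eq V E w w'}"

definition RAAG :: "'v set \<Rightarrow> 'v set set \<Rightarrow> ('v \<times> bool) list set monoid" where
  "RAAG V E = \<lparr>carrier = raag_class V E ` lists (V \<times> UNIV),
     mult = (\<lambda>X Y. {w. \<exists>x\<in>X. \<exists>y\<in>Y. raag_eq V E (x @ y) w}),
     one = raag_class V E []\<rparr>"

end

theory Submission
  imports Defs
begin

text \<open>Fix a symbol \<open>mark\<close>. A configuration is cut by its marks into gaps, and the length of a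
  gap is read as a label, so that the marks form a path with labelled edges. The label
  \<open>d\<close> acts by exchanging the two ends of every gap of length \<open>d\<close>, except when the gap meets
  another gap of length at most \<open>d\<close> whose label is equal to or commutes with \<open>d\<close>. The bound makes
  this rule local even when there are infinitely many labels, and it still separates any two gaps
  with commuting labels, because the longer one is disabled.
  Hence the labels act by involutions, and commuting labels have commuting actions.

  Each vertex \<open>v\<close> receives two labels and acts by the product of their involutions. For a reduced
  nonempty word, select greedily a chain of letters, each being the next one that does not commute
  with its predecessor. On the path labelled by this chain, every selected letter moves the walker
  one gap to the right and all other letters leave it in place, so the word acts nontrivially.\<close>

section \<open>Local maps and the topological full group\<close>

text \<open>A map that reads only a finite window is constant on a cylinder around each point;
  \<open>T\<close> is that cylinder.\<close>

lemma continuous_map_shift_space_local: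
  fixes f :: "(int \<Rightarrow> 'a) \<Rightarrow> 'b"
  assumes loc: "\<And>x y. (\<And>i. i \<in> {a..b} \<Longrightarrow> x i = y i) \<Longrightarrow> f x = f y"
  shows "continuous_map shift_space (discrete_topology UNIV) f"
proof -
  have "openin shift_space {x. f x \<in> U}" for U
  proof (subst openin_subopen, safe)
    fix x assume x: "f x \<in> U"
    define T where "T = (\<Pi>\<^sub>E i\<in>UNIV. if i \<in> {a..b} then {x i} else UNIV)"
    have "openin shift_space T"
      unfolding shift_space_def T_def
    proof (rule product_topology_basis)
      show "finite {i. (if i \<in> {a..b} then {x i} else UNIV) \<noteq> topspace (discrete_topology UNIV)}"
        by (rule finite_subset[of _ "{a..b}"]) auto
    qed auto
    moreover have "x \<in> T" by (auto simp: T_def)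
    moreover have "T \<subseteq> {x. f x \<in> U}"
    proof
      fix y assume "y \<in> T"
      then have "y i = x i" if "i \<in> {a..b}" for i
        using PiE_mem[OF \<open>y \<in> T\<close>[unfolded T_def], of i] that by simp
      then have "f y = f x" by (rule loc)
      with x show "y \<in> {x. f x \<in> U}" by simp
    qed
    ultimately show "\<exists>T. openin shift_space T \<and> x \<in> T \<and> T \<subseteq> {x. f x \<in> U}" by blast
  qed
  then show ?thesis
    by (simp add: continuous_map_def shift_space_def)
qed

lemma shift_pow_0 [simp]: "shift_pow 0 x = x"
  by (simp add: shift_pow_def)

lemma shift_pow_shift_pow [simp]: "shift_pow m (shift_pow n x) = shift_pow (n + m) x"
  by (simp add: shift_pow_def add_ac)

lemma continuous_map_discrete_add:
  fixes f g :: "'x \<Rightarrow> 'b::ab_group_add"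
  assumes "continuous_map X (discrete_topology UNIV) f"
    and "continuous_map X (discrete_topology UNIV) g"
  shows "continuous_map X (discrete_topology UNIV) (\<lambda>x. f x + g x)"
proof -
  have f: "openin X {x \<in> topspace X. f x \<in> U}" and g: "openin X {x \<in> topspace X. g x \<in> U}" for U
    using assms by (auto simp: continuous_map_def)
  have "openin X {x \<in> topspace X. f x + g x \<in> U}" for U
  proof -
    have "{x \<in> topspace X. f x + g x \<in> U} =
      (\<Union>a. {x \<in> topspace X. f x \<in> {a}} \<inter> {x \<in> topspace X. g x \<in> {b. a + b \<in> U}})"
      by auto
    also have "openin X \<dots>"
    proof (rule openin_Union, elim imageE, hypsubst)
      fix a
      show "openin X ({x \<in> topspace X. f x \<in> {a}} \<inter> {x \<in> topspace X. g x \<in> {b. a + b \<in> U}})"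
        by (intro openin_Int f g)
    qed
    finally show ?thesis .
  qed
  then show ?thesis by (simp add: continuous_map_def)
qed

lemma id_in_tfg_carrier: "id \<in> tfg_carrier"
proof -
  have "homeomorphic_map shift_space shift_space (id :: (int \<Rightarrow> 'a) \<Rightarrow> _)"
    by (rule homeomorphic_map_id[THEN iffD2, OF refl])
  moreover have "continuous_map shift_space (discrete_topology UNIV) (\<lambda>_ :: int \<Rightarrow> 'a. 0 :: int)"
    by simp
  ultimately show ?thesis
    unfolding tfg_carrier_def by (auto intro!: exI[of _ "\<lambda>_. 0"])
qed

lemma comp_in_tfg_carrier:
  assumes "f \<in> tfg_carrier" "g \<in> tfg_carrier"
  shows "f \<circ> g \<in> tfg_carrier"
proof -
  obtain c where hf: "homeomorphic_map shift_space shift_space f"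
    and c: "continuous_map shift_space (discrete_topology UNIV) c" "\<And>x. f x = shift_pow (c x) x"
    using assms(1) by (auto simp: tfg_carrier_def)
  obtain e where hg: "homeomorphic_map shift_space shift_space g"
    and e: "continuous_map shift_space (discrete_topology UNIV) e" "\<And>x. g x = shift_pow (e x) x"
    using assms(2) by (auto simp: tfg_carrier_def)
  have "homeomorphic_map shift_space shift_space (f \<circ> g)"
    by (rule homeomorphic_map_compose[OF hg hf])
  \<comment> \<open>The cocycle rule: \<open>g\<close> shifts by \<open>e x\<close>, then
    \<open>f\<close> shifts by the value of \<open>c\<close> at \<open>g x\<close>.\<close>
  moreover have "continuous_map shift_space (discrete_topology UNIV) (\<lambda>x. e x + (c \<circ> g) x)"
    by (intro continuous_map_discrete_add e(1)
        continuous_map_compose[OF homeomorphic_imp_continuous_map[OF hg] c(1)])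
  moreover have "(f \<circ> g) x = shift_pow (e x + (c \<circ> g) x) x" for x
    unfolding o_def c(2)[of "g x"] by (simp add: e(2))
  ultimately show ?thesis unfolding tfg_carrier_def by blast
qed

section \<open>Exchanging the ends of gaps\<close>

locale gap_walk =
  fixes mark :: 'a and R :: "int \<Rightarrow> int \<Rightarrow> bool"
  assumes R_refl: "R d d" and R_sym: "R d e \<Longrightarrow> R e d"
begin

definition gap :: "(int \<Rightarrow> 'a) \<Rightarrow> int \<Rightarrow> int \<Rightarrow> bool" where
  "gap x p d \<longleftrightarrow> 0 < d \<and> x p = mark \<and> x (p + d) = mark \<and> (\<forall>j. p < j \<and> j < p + d \<longrightarrow> x j \<noteq> mark)"

text \<open>\<open>gap x (p - e) e\<close> is the gap that ends at \<open>p\<close>. As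
  \<open>R\<close> is reflexive, adjacent gaps of equal length disable each other.\<close>

definition active :: "(int \<Rightarrow> 'a) \<Rightarrow> int \<Rightarrow> int \<Rightarrow> bool" where
  "active x p d \<longleftrightarrow> gap x p d \<and> (\<forall>e\<le>d. R e d \<longrightarrow> \<not> gap x (p + d) e \<and> \<not> gap x (p - e) e)"

text \<open>The walker stands at the origin, and its displacement is the cocycle of
  \<open>swap\<close>. The two tests never both succeed, by \<open>active_disjoint\<close>, so their
  order is immaterial.\<close>

definition jump :: "int \<Rightarrow> (int \<Rightarrow> 'a) \<Rightarrow> int" where
  "jump d x = (if active x 0 d then d else if active x (- d) d then - d else 0)"

definition swap :: "int \<Rightarrow> (int \<Rightarrow> 'a) \<Rightarrow> (int \<Rightarrow> 'a)" where
  "swap d x = shift_pow (jump d x) x"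

lemma gap_inner: "gap x p d \<Longrightarrow> p < j \<Longrightarrow> j < p + d \<Longrightarrow> x j \<noteq> mark"
  by (simp add: gap_def)

lemma gap_cong:
  assumes "\<And>j. p \<le> j \<Longrightarrow> j \<le> p + d \<Longrightarrow> x j = y j"
  shows "gap x p d = gap y p d"
proof (cases "0 < d")
  case True
  have "x p = y p" "x (p + d) = y (p + d)" using assms True by auto
  moreover have "p < j \<and> j < p + d \<Longrightarrow> x j = y j" for j using assms by auto
  ultimately show ?thesis unfolding gap_def by metis
qed (simp add: gap_def)

text \<open>A neighbour able to disable the gap has length at most \<open>d\<close>, so it stays
  within distance \<open>d\<close> of the gap.\<close>

lemma active_cong:
  assumes "\<And>j. p - d \<le> j \<Longrightarrow> j \<le> p + 2 * d \<Longrightarrow> x j = y j"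
  shows "active x p d = active y p d"
proof -
  have gaps: "gap x q e = gap y q e" if "p - d \<le> q" "q + e \<le> p + 2 * d" for q e
    using that by (intro gap_cong assms) auto
  show ?thesis
  proof (cases "0 < d")
    case True
    then have "gap x p d = gap y p d"
      and "\<And>e. e \<le> d \<Longrightarrow> gap x (p + d) e = gap y (p + d) e"
      and "\<And>e. e \<le> d \<Longrightarrow> gap x (p - e) e = gap y (p - e) e"
      by (auto intro!: gaps)
    then show ?thesis unfolding active_def by metis
  qed (simp add: active_def gap_def)
qed

lemma jump_cong:
  assumes "\<And>j. - 2 * \<bar>d\<bar> \<le> j \<Longrightarrow> j \<le> 2 * \<bar>d\<bar> \<Longrightarrow> x j = y j"
  shows "jump d x = jump d y"
proof -
  have "active x 0 d = active y 0 d" "active x (- d) d = active y (- d) d"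
    by (rule active_cong, rule assms; linarith)+
  then show ?thesis by (simp add: jump_def)
qed

lemma abs_jump_le: "\<bar>jump d x\<bar> \<le> \<bar>d\<bar>"
  by (simp add: jump_def)

lemma gap_shift_pow [simp]: "gap (shift_pow n x) p d = gap x (p + n) d"
proof -
  have "(\<forall>j. p < j \<and> j < p + d \<longrightarrow> x (j + n) \<noteq> mark) \<longleftrightarrow>
    (\<forall>j. p + n < j \<and> j < p + n + d \<longrightarrow> x j \<noteq> mark)"
    (is "?L \<longleftrightarrow> ?R")
  proof
    show "?R" if ?L
      using that[rule_format, of "j - n" for j] by auto
    show "?L" if ?R
      using that by simp
  qed
  then show ?thesis by (simp add: gap_def shift_pow_def add_ac)
qed

lemma active_shift_pow [simp]: "active (shift_pow n x) p d = active x (p + n) d"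
  by (simp add: active_def algebra_simps)

section \<open>Swaps as involutions, commuting for related labels\<close>

lemma gap_start_unique:
  assumes "gap x p d" "gap x p e"
  shows "d = e"
  using gap_inner[OF assms(1), of "p + e"] gap_inner[OF assms(2), of "p + d"] assms
  unfolding gap_def by (cases d e rule: linorder_cases) auto

lemma gap_end_unique:
  assumes "gap x p d" "gap x q e" "p + d = q + e"
  shows "d = e"
  using gap_inner[OF assms(1), of q] gap_inner[OF assms(2), of p] assms
  unfolding gap_def by (cases p q rule: linorder_cases) auto

text \<open>Gaps with a common left end or a common right end coincide. If one ends where the other
  begins, the one that is not longer disables the other.\<close>

lemma active_disjoint:
  assumes act: "active x p d" "active x q e" and R: "R d e" and ne: "(p, d) \<noteq> (q, e)"
  shows "{p, p + d} \<inter> {q, q + e} = {}"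
proof -
  have g: "gap x p d" "gap x q e" using act by (auto simp: active_def)
  have "p \<noteq> q" using g ne gap_start_unique by blast
  moreover have "p + d \<noteq> q + e" using g ne gap_end_unique[OF g] by auto
  moreover have "p + d \<noteq> q"
  proof
    assume eq: "p + d = q"
    then show False
      using act g R R_sym[OF R] unfolding active_def
      by (metis add_diff_cancel_right' linorder_le_cases)
  qed
  moreover have "q + e \<noteq> p"
  proof
    assume eq: "q + e = p"
    then show False
      using act g R R_sym[OF R] unfolding active_def
      by (metis add_diff_cancel_right' linorder_le_cases)
  qed
  ultimately show ?thesis by auto
qed

lemma swap_swap: "swap d (swap d x) = x"
proof -
  consider "active x 0 d" | "\<not> active x 0 d" "active x (- d) d"
    | "\<not> active x 0 d" "\<not> active x (- d) d" by blast
  then show ?thesis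
  proof cases
    case 1
    then have "d \<noteq> 0" by (auto simp: active_def gap_def)
    \<comment> \<open>After the jump the gap lies to the left of the origin, but \<open>jump\<close>
      first looks for an active gap on the right; disjointness excludes one.\<close>
    then have "\<not> active x d d" using active_disjoint[OF 1 _ R_refl, of d] by auto
    with 1 show ?thesis by (simp add: swap_def jump_def)
  qed (simp_all add: swap_def jump_def)
qed

text \<open>Neither end of the active \<open>d\<close>-gap used by the walker meets an active
  \<open>e\<close>-gap, so \<open>e\<close> moves it neither before nor after the jump.\<close>

lemma jump_eq_0_if_R:
  assumes "R d e" "d \<noteq> e" "jump d x \<noteq> 0"
  shows "jump e x = 0" "jump e (swap d x) = 0"
proof -
  obtain p where p: "active x p d"
    and cs: "p = 0 \<and> jump d x = d \<or> p = - d \<and> jump d x = - d"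
    using assms(3) unfolding jump_def by (metis (full_types))
  have dis: "\<not> active x q e" if "{p, p + d} \<inter> {q, q + e} \<noteq> {}" for q
    using active_disjoint[OF p, of q e] assms that by auto
  have "\<not> active x 0 e" "\<not> active x (- e) e"
    "\<not> active x (jump d x) e" "\<not> active x (- e + jump d x) e"
    by (rule dis, use cs in force)+
  then show "jump e x = 0" "jump e (swap d x) = 0"
    by (simp_all add: jump_def[of e] swap_def)
qed

text \<open>For distinct labels, wherever one swap moves a configuration the other fixes both it and
  its image.\<close>

lemma swap_commute:
  assumes "R d e"
  shows "swap d (swap e x) = swap e (swap d x)"
proof (cases "d = e")
  case False
  have fixed: "swap c y = y" if "jump c y = 0" for c y
    using that by (simp add: swap_def)
  show ?thesis
    using jump_eq_0_if_R[OF assms False, of x] jump_eq_0_if_R[OF R_sym[OF assms], of x] False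
    by (metis fixed)
qed simp

section \<open>Continuity of swaps\<close>

lemma continuous_map_jump: "continuous_map shift_space (discrete_topology UNIV) (jump d)"
  by (rule continuous_map_shift_space_local[of "- 2 * \<bar>d\<bar>" "2 * \<bar>d\<bar>"]) (rule jump_cong, simp)

lemma continuous_map_swap: "continuous_map shift_space shift_space (swap d)"
proof -
  have "continuous_map shift_space (discrete_topology UNIV) (\<lambda>x. swap d x i)" for i
  \<comment> \<open>The value at \<open>i\<close> is read at \<open>i + jump d x\<close>, so the
    window of the jump is widened by the absolute value of \<open>i\<close>.\<close>
  proof (rule continuous_map_shift_space_local[of "- 2 * \<bar>d\<bar> - \<bar>i\<bar>" "2 * \<bar>d\<bar> + \<bar>i\<bar>"])
    fix x y :: "int \<Rightarrow> 'a"
    assume eq: "\<And>j. j \<in> {- 2 * \<bar>d\<bar> - \<bar>i\<bar>..2 * \<bar>d\<bar> + \<bar>i\<bar>} \<Longrightarrow> x j = y j"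
    have "jump d x = jump d y" by (intro jump_cong eq) auto
    moreover have "x (i + jump d x) = y (i + jump d x)"
      using abs_jump_le[of d x] by (intro eq) auto
    ultimately show "swap d x i = swap d y i" by (simp add: swap_def shift_pow_def)
  qed
  then show ?thesis
    by (subst (2) shift_space_def) (simp add: continuous_map_componentwise_UNIV)
qed

lemma swap_in_tfg_carrier: "swap d \<in> tfg_carrier"
proof -
  have "homeomorphic_maps shift_space shift_space (swap d) (swap d)"
    by (simp add: homeomorphic_maps_def continuous_map_swap swap_swap)
  then have "homeomorphic_map shift_space shift_space (swap d)"
    using homeomorphic_maps_imp_map by blast
  then show ?thesis
    unfolding tfg_carrier_def using continuous_map_jump swap_def by blast
qed

section \<open>The greedy chain of a reduced word\<close>

text \<open>Read labels as involutions, with \<open>R\<close> as commutation. Then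
  \<open>fresh\<close> says that no \<open>d\<close> in the list can be brought to its front by
  commutations, and \<open>reduced\<close> describes the reduced words of a right-angled Coxeter
  group.\<close>

fun fresh :: "int \<Rightarrow> int list \<Rightarrow> bool" where
  "fresh d [] = True"
| "fresh d (e # D) = (\<not> R d e \<or> (e \<noteq> d \<and> fresh d D))"

fun reduced :: "int list \<Rightarrow> bool" where
  "reduced [] = True"
| "reduced (d # D) = (fresh d D \<and> reduced D)"

text \<open>\<open>d\<close> is the letter selected last; the full chain of \<open>d # D\<close> is
  \<open>d # chain d D\<close>.\<close>

fun chain :: "int \<Rightarrow> int list \<Rightarrow> int list" where
  "chain d [] = []"
| "chain d (e # D) = (if R d e then chain d D else e # chain e D)"

text \<open>The base clause leaves no mark beyond the path, so no gap begins at its end.\<close>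

fun gap_path :: "(int \<Rightarrow> 'a) \<Rightarrow> int \<Rightarrow> int list \<Rightarrow> bool" where
  "gap_path x p [] = (\<forall>j>p. x j \<noteq> mark)"
| "gap_path x p (d # D) = (gap x p d \<and> gap_path x (p + d) D)"

lemma set_chain_subset: "set (chain d D) \<subseteq> set D"
  by (induction D arbitrary: d) auto

text \<open>A gap starting at \<open>p\<close> must carry the first chain letter, which the greedy
  choice makes unrelated to \<open>d\<close>.\<close>

lemma gap_path_chain_not_R:
  assumes "gap_path x p (chain d D)" "gap x p e"
  shows "\<not> R d e"
  using assms
proof (induction D)
  case Nil
  then show ?case by (auto simp: gap_def)
next
  case (Cons c D)
  then show ?case using gap_start_unique by (auto split: if_splits)
qed

lemma swap_gap_forward:
  assumes "gap x p d" "\<And>e. gap x (p - e) e \<Longrightarrow> \<not> R e d" "\<And>e. gap x (p + d) e \<Longrightarrow> \<not> R d e"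
  shows "swap d (shift_pow p x) = shift_pow (p + d) x"
proof -
  have "active x p d" using assms R_sym unfolding active_def by blast
  then show ?thesis by (simp add: swap_def jump_def)
qed

lemma swap_no_gap:
  assumes "\<not> gap x p d" "\<not> gap x (p - d) d"
  shows "swap d (shift_pow p x) = shift_pow p x"
  using assms by (simp add: swap_def jump_def active_def)

text \<open>Invariant: the walker is at \<open>p\<close>, with the gap of the last selected letter
  \<open>d\<close> on its left and the rest of the chain on its right. A letter related to
  \<open>d\<close> labels neither adjacent gap: freshness excludes the left one, greediness the
  right one. An unrelated letter labels the right gap, whose neighbours are both unrelated to it, so
  it is crossed.\<close>

lemma fold_swap_chain:
  assumes "fresh d D" "reduced D" "gap x (p - d) d" "gap_path x p (chain d D)"
  shows "fold swap D (shift_pow p x) = shift_pow (p + sum_list (chain d D)) x"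
  using assms
proof (induction D arbitrary: d p)
  case (Cons e D)
  have left: "c = d" if "gap x (p - c) c" for c
    using gap_end_unique[OF that Cons.prems(3)] by simp
  show ?case
  proof (cases "R d e")
    case True
    then have "e \<noteq> d" "fresh d D" using Cons.prems(1) by auto
    moreover have "\<not> gap x p e"
      using gap_path_chain_not_R[OF Cons.prems(4)] True by blast
    moreover have "\<not> gap x (p - e) e" using left \<open>e \<noteq> d\<close> by blast
    ultimately show ?thesis
      using Cons True by (simp add: swap_no_gap)
  next
    case False
    then have path: "gap x p e" "gap_path x (p + e) (chain e D)" using Cons.prems(4) by auto
    have "swap e (shift_pow p x) = shift_pow (p + e) x"
      using path gap_path_chain_not_R[OF path(2)] left False by (intro swap_gap_forward) auto
    moreover have "fold swap D (shift_pow (p + e) x) = shift_pow (p + e + sum_list (chain e D)) x"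
      using Cons.prems(2) path by (intro Cons.IH) auto
    ultimately show ?thesis using False by (simp add: add_ac)
  qed
qed simp

lemma gap_path_cong:
  assumes "\<And>j. p \<le> j \<Longrightarrow> x j = y j" "\<And>d. d \<in> set D \<Longrightarrow> 0 < d"
  shows "gap_path x p D = gap_path y p D"
  using assms
proof (induction D arbitrary: p)
  case (Cons d D)
  have "gap x p d = gap y p d" using Cons.prems by (intro gap_cong) auto
  moreover have "gap_path x (p + d) D = gap_path y (p + d) D"
  proof (rule Cons.IH)
    fix j assume "p + d \<le> j"
    moreover have "0 < d" using Cons.prems by simp
    ultimately show "x j = y j" using Cons.prems(1)[of j] by linarith
  qed (use Cons.prems in auto)
  ultimately show ?case by simp
qed auto

text \<open>Built from right to left by placing one more mark. The absence of marks before
  \<open>p\<close> makes the new gap empty inside, and later ensures that no gap ends at the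
  start.\<close>

lemma ex_gap_path:
  assumes "(blank :: 'a) \<noteq> mark" "\<And>d. d \<in> set D \<Longrightarrow> 0 < d"
  shows "\<exists>x. gap_path x p D \<and> x p = mark \<and> (\<forall>j<p. x j \<noteq> mark)"
  using assms(2)
proof (induction D arbitrary: p)
  case Nil
  show ?case using assms(1) by (intro exI[of _ "(\<lambda>_. blank)(p := mark)"]) auto
next
  case (Cons d D)
  have "0 < d" using Cons.prems by simp
  obtain x where x: "gap_path x (p + d) D" "x (p + d) = mark" "\<forall>j<p + d. x j \<noteq> mark"
    using Cons.IH[of "p + d"] Cons.prems by auto
  let ?y = "x(p := mark)"
  have "gap_path ?y (p + d) D"
  proof (subst gap_path_cong[of _ _ x])
    show "?y j = x j" if "p + d \<le> j" for j using that \<open>0 < d\<close> by auto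
  qed (use x(1) Cons.prems in auto)
  moreover have "gap ?y p d" using x \<open>0 < d\<close> by (auto simp: gap_def)
  moreover have "?y p = mark" "\<forall>j<p. ?y j \<noteq> mark" using x(3) \<open>0 < d\<close> by auto
  ultimately show ?case unfolding gap_path.simps by blast
qed

lemma fold_swap_reduced_ne_id:
  assumes "(blank :: 'a) \<noteq> mark" "\<And>d. d \<in> set D \<Longrightarrow> 0 < d" "reduced D" "D \<noteq> []"
  shows "fold swap D \<noteq> id"
proof
  assume id: "fold swap D = id"
  obtain d D' where D: "D = d # D'" using assms(4) by (cases D) auto
  have pos: "0 < c" if "c \<in> set (d # chain d D')" for c
    using that set_chain_subset[of d D'] assms(2) D by auto
  obtain x where x: "gap_path x 0 (d # chain d D')" "x 0 = mark" "\<forall>j<0. x j \<noteq> mark"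
    using ex_gap_path[OF assms(1) pos, of _ 0] by blast
  define q where "q = d + sum_list (chain d D')"
  have "0 \<le> sum_list (chain d D')" using pos by (intro sum_list_nonneg) (simp add: less_imp_le)
  then have q: "0 < q" using pos[of d] by (simp add: q_def)
  have path: "gap x 0 d" "gap_path x d (chain d D')" using x(1) by auto
  have "swap d (shift_pow 0 x) = shift_pow (0 + d) x"
  proof (rule swap_gap_forward)
    show "\<not> R e d" if "gap x (0 - e) e" for e using that x(3)[rule_format, of "- e"] by (auto simp: gap_def)
    show "\<not> R d e" if "gap x (0 + d) e" for e using that gap_path_chain_not_R[OF path(2)] by auto
  qed (rule path(1))
  moreover have "fold swap D' (shift_pow d x) = shift_pow q x"
    unfolding q_def using assms(3) D path by (intro fold_swap_chain) auto
  ultimately have "fold swap D x = shift_pow q x" by (simp add: D)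
  \<comment> \<open>A nonzero shift could fix a periodic configuration; this one has a leftmost
    mark, at 0.\<close>
  then have "x = shift_pow q x" using id by simp
  then have "x (- q) = x 0" by (metis add.left_inverse shift_pow_def)
  with x q show False by simp
qed

end

section \<open>Words in right-angled Artin groups\<close>

lemma raag_eq_refl [simp]: "raag_eq V E w w"
  by (simp add: raag_eq_def)

lemma raag_eq_sym: "raag_eq V E w w' \<Longrightarrow> raag_eq V E w' w"
  unfolding raag_eq_def by (rule equivclp_sym)

lemma raag_eq_trans [trans]: "raag_eq V E w w' \<Longrightarrow> raag_eq V E w' w'' \<Longrightarrow> raag_eq V E w w''"
  unfolding raag_eq_def by (rule equivclp_trans)

lemma raag_eq_invariant:
  assumes "raag_eq V E w w'" "\<And>u u'. raag_step V E u u' \<Longrightarrow> f u = f u'"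
  shows "f w = f w'"
  using assms(1) unfolding raag_eq_def
  by (induction rule: equivclp_induct) (use assms(2) in metis)+

lemma raag_eq_map:
  assumes "raag_eq V E w w'" "\<And>u u'. raag_step V E u u' \<Longrightarrow> raag_eq V E (f u) (f u')"
  shows "raag_eq V E (f w) (f w')"
proof -
  \<comment> \<open>The invariant attached to \<open>u\<close> is the whole predicate
    \<open>raag_eq V E (f u)\<close>.\<close>
  have "raag_eq V E (f w) = raag_eq V E (f w')"
  proof (rule raag_eq_invariant[OF assms(1)])
    show "raag_eq V E (f u) = raag_eq V E (f u')" if "raag_step V E u u'" for u u'
      using assms(2)[OF that] by (auto intro: raag_eq_sym raag_eq_trans)
  qed
  then show ?thesis by simp
qed

lemma raag_step_imp_eq: "raag_step V E w w' \<Longrightarrow> raag_eq V E w w'"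
  unfolding raag_eq_def by (rule r_into_equivclp)

lemma raag_step_context:
  assumes "raag_step V E w w'"
  shows "raag_step V E (a @ w @ b) (a @ w' @ b)"
  using assms
proof cases
  case (cancel v xs c ys)
  then show ?thesis using raag_step.cancel[of v V E "a @ xs" c "ys @ b"] by simp
next
  case (commute u v xs c d ys)
  then show ?thesis using raag_step.commute[of u v E V "a @ xs" c d "ys @ b"] by simp
qed

lemma raag_eq_context: "raag_eq V E w w' \<Longrightarrow> raag_eq V E (a @ w @ b) (a @ w' @ b)"
  by (erule raag_eq_map) (intro raag_step_imp_eq raag_step_context)

text \<open>Both kinds of step are symmetric under reversal. This links \<open>foldr\<close>, by
  which words act, with \<open>fold\<close>, by which the chain argument reads them.\<close>

lemma raag_step_rev:
  assumes "raag_step V E w w'"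
  shows "raag_eq V E (rev w) (rev w')"
  using assms
proof cases
  case (cancel v xs c ys)
  then show ?thesis
    using raag_step.cancel[of v V E "rev ys" "\<not> c" "rev xs"] by (auto intro: raag_step_imp_eq)
next
  case (commute u v xs c d ys)
  then show ?thesis
    using raag_step.commute[of v u E V "rev ys" d c "rev xs"]
    by (auto intro: raag_step_imp_eq simp: insert_commute)
qed

lemma raag_eq_rev: "raag_eq V E w w' \<Longrightarrow> raag_eq V E (rev w) (rev w')"
  by (erule raag_eq_map) (rule raag_step_rev)

definition inverse_word :: "('v \<times> bool) list \<Rightarrow> ('v \<times> bool) list" where
  "inverse_word w = rev (map (map_prod id Not) w)"

lemma inverse_word_in_lists: "w \<in> lists (V \<times> UNIV) \<Longrightarrow> inverse_word w \<in> lists (V \<times> UNIV)"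
  by (auto simp: inverse_word_def lists_eq_set map_prod_def)

lemma inverse_word_append_raag_eq:
  assumes "w \<in> lists (V \<times> UNIV)"
  shows "raag_eq V E (inverse_word w @ w) []"
  using assms
proof (induction w)
  case (Cons l w)
  obtain v b where l: "l = (v, b)" by (cases l)
  have "raag_eq V E (inverse_word w @ [(v, \<not> b), (v, \<not> \<not> b)] @ w) (inverse_word w @ w)"
    using Cons.hyps l by (intro raag_step_imp_eq raag_step.cancel) auto
  also have "raag_eq V E \<dots> []" by (rule Cons.IH)
  finally show ?case by (simp add: inverse_word_def l)
qed (simp add: inverse_word_def)

lemma append_inverse_word_raag_eq:
  assumes "w \<in> lists (V \<times> UNIV)"
  shows "raag_eq V E (w @ inverse_word w) []"
proof -
  have "inverse_word (inverse_word w) = w"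
    by (simp add: inverse_word_def rev_map prod.map_comp comp_def map_idI split_beta)
  then show ?thesis
    using inverse_word_append_raag_eq[OF inverse_word_in_lists[OF assms], of E] by simp
qed

lemma raag_eq_commute_past:
  assumes "\<And>l. l \<in> set ys \<Longrightarrow> {fst l, v} \<in> E"
  shows "raag_eq V E ((v, b) # ys) (ys @ [(v, b)])"
  using assms
proof (induction ys)
  case (Cons l ys)
  have "{v, fst l} \<in> E" using Cons.prems[of l] by (simp add: insert_commute)
  then have "raag_eq V E ([] @ [(v, b), (fst l, snd l)] @ ys) ([] @ [(fst l, snd l), (v, b)] @ ys)"
    by (intro raag_step_imp_eq raag_step.commute)
  also have "raag_eq V E \<dots> ([l] @ (ys @ [(v, b)]) @ [])"
    using raag_eq_context[OF Cons.IH, of "[l]" "[]"] Cons.prems by simp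
  finally show ?case by simp
qed simp

lemma raag_eq_cancel_past:
  assumes "v \<in> V" "\<And>l. l \<in> set ys \<Longrightarrow> {fst l, v} \<in> E"
  shows "raag_eq V E (xs @ (v, b) # ys @ (v, \<not> b) # zs) (xs @ ys @ zs)"
proof -
  have "raag_eq V E (xs @ ((v, b) # ys) @ (v, \<not> b) # zs) (xs @ (ys @ [(v, b)]) @ (v, \<not> b) # zs)"
    by (intro raag_eq_context raag_eq_commute_past assms(2))
  also have "raag_eq V E \<dots> ((xs @ ys) @ zs)"
    using raag_step.cancel[OF assms(1), of E "xs @ ys" b zs] by (auto intro: raag_step_imp_eq)
  finally show ?thesis by simp
qed

section \<open>The embedding\<close>

text \<open>Both \<open>\<phi> (v, True)\<close> and \<open>\<phi> (v, False)\<close> are labels of the vertex \<open>v\<close>; the boolean is not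
  an exponent here.\<close>

definition label_rel :: "'v set set \<Rightarrow> ('v \<times> bool \<Rightarrow> int) \<Rightarrow> int \<Rightarrow> int \<Rightarrow> bool" where
  "label_rel E \<phi> d e \<longleftrightarrow> d = e \<or> (\<exists>u v b c. {u, v} \<in> E \<and> d = \<phi> (u, b) \<and> e = \<phi> (v, c))"

locale raag_action = gap_walk mark "label_rel E \<phi>"
  for mark :: 'a and V :: "'v set" and E :: "'v set set" and \<phi> :: "'v \<times> bool \<Rightarrow> int" +
  fixes blank :: 'a
  assumes simple: "simple_graph V E" and inj: "inj_on \<phi> (V \<times> UNIV)"
    and pos: "0 < \<phi> l" and blank: "blank \<noteq> mark"
begin

lemma edge_vertices: "{u, v} \<in> E \<Longrightarrow> u \<noteq> v \<and> u \<in> V \<and> v \<in> V"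
  using simple unfolding simple_graph_def by (metis doubleton_eq_iff)

text \<open>Injectivity of \<open>\<phi>\<close> recovers letters from labels. In particular the two
  labels of one vertex are unrelated, as there are no loops.\<close>

lemma label_rel_iff:
  assumes "u \<in> V" "v \<in> V"
  shows "label_rel E \<phi> (\<phi> (u, b)) (\<phi> (v, c)) \<longleftrightarrow> (u, b) = (v, c) \<or> {u, v} \<in> E"
proof -
  have eq: "\<phi> (u, b) = \<phi> (v, c) \<longleftrightarrow> (u, b) = (v, c)" if "u \<in> V" "v \<in> V" for u v b c
    using inj that by (auto dest: inj_onD)
  show ?thesis
    unfolding label_rel_def using eq assms edge_vertices by (metis Pair_inject)
qed

text \<open>The boolean selects which of the two involutions of the vertex comes first; the opposite
  order gives the inverse.\<close>

definition letter_act :: "'v \<times> bool \<Rightarrow> (int \<Rightarrow> 'a) \<Rightarrow> (int \<Rightarrow> 'a)" where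
  "letter_act l = swap (\<phi> (fst l, \<not> snd l)) \<circ> swap (\<phi> l)"

lemma letter_act_cancel: "letter_act (v, \<not> b) \<circ> letter_act (v, b) = id"
  by (auto simp: letter_act_def swap_swap)

lemma letter_act_commute:
  assumes "{u, v} \<in> E"
  shows "letter_act (u, a) \<circ> letter_act (v, b) = letter_act (v, b) \<circ> letter_act (u, a)"
proof -
  have "label_rel E \<phi> (\<phi> (u, c)) (\<phi> (v, d))" for c d
    using assms by (auto simp: label_rel_def)
  then have "swap (\<phi> (u, c)) (swap (\<phi> (v, d)) x) = swap (\<phi> (v, d)) (swap (\<phi> (u, c)) x)" for c d x
    by (rule swap_commute)
  then show ?thesis by (simp add: letter_act_def comp_def)
qed

definition word_act :: "('v \<times> bool) list \<Rightarrow> (int \<Rightarrow> 'a) \<Rightarrow> (int \<Rightarrow> 'a)" where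
  "word_act w = foldr letter_act w"

lemma word_act_Nil [simp]: "word_act [] = id"
  by (simp add: word_act_def id_def)

lemma word_act_append: "word_act (w @ w') = word_act w \<circ> word_act w'"
  by (rule ext) (simp add: word_act_def)

lemma word_act_raag_step:
  assumes "raag_step V E w w'"
  shows "word_act w = word_act w'"
  using assms
proof cases
  case (cancel v xs b ys)
  have "letter_act (v, b) \<circ> letter_act (v, \<not> b) = id"
    using letter_act_cancel[of v "\<not> b"] by simp
  with cancel show ?thesis
    by (intro ext) (simp add: word_act_def pointfree_idE)
next
  case (commute u v xs a b ys)
  then have "letter_act (u, a) (letter_act (v, b) x) = letter_act (v, b) (letter_act (u, a) x)" for x
    using letter_act_commute[of u v a b] by (metis comp_apply)
  with commute show ?thesis
    by (intro ext) (simp add: word_act_def)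
qed

lemma word_act_raag_eq: "raag_eq V E w w' \<Longrightarrow> word_act w = word_act w'"
  by (erule raag_eq_invariant) (rule word_act_raag_step)

lemma word_act_in_tfg_carrier: "word_act w \<in> tfg_carrier"
proof (induction w)
  case (Cons l w)
  have "word_act (l # w) = (swap (\<phi> (fst l, \<not> snd l)) \<circ> swap (\<phi> l)) \<circ> word_act w"
    by (simp add: word_act_def letter_act_def)
  then show ?case by (simp only:) (intro comp_in_tfg_carrier swap_in_tfg_carrier Cons)
qed (simp only: word_act_Nil id_in_tfg_carrier)

section \<open>Faithfulness of the action on words\<close>

fun expand :: "('v \<times> bool) list \<Rightarrow> int list" where
  "expand [] = []"
| "expand ((v, b) # w) = \<phi> (v, b) # \<phi> (v, \<not> b) # expand w"

lemma fold_swap_expand: "fold swap (expand w) = fold letter_act w"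
  by (induction w rule: expand.induct) (simp_all add: letter_act_def o_assoc)

lemma expand_pos: "d \<in> set (expand w) \<Longrightarrow> 0 < d"
  by (induction w rule: expand.induct) (auto simp: pos)

text \<open>Letters adjacent to \<open>v\<close> are passed over. The first other letter
  \<open>(u, c)\<close> differs from \<open>(v, \<not> b)\<close> by hypothesis, so its first label
  is unrelated to \<open>\<phi> (v, \<not> b)\<close> and stops the search, even when it is
  \<open>(v, b)\<close> itself.\<close>

lemma fresh_expand:
  assumes "v \<in> V" "w \<in> lists (V \<times> UNIV)"
    and "\<And>ys zs. w = ys @ (v, \<not> b) # zs \<Longrightarrow> \<exists>l\<in>set ys. {fst l, v} \<notin> E"
  shows "fresh (\<phi> (v, \<not> b)) (expand w)"
  using assms(2,3)
proof (induction w rule: expand.induct)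
  case (2 u c w)
  have u: "u \<in> V" using 2(2) by auto
  show ?case
  proof (cases "{u, v} \<in> E")
    case True
    have "fresh (\<phi> (v, \<not> b)) (expand w)"
    proof (rule "2.IH")
      fix ys zs assume "w = ys @ (v, \<not> b) # zs"
      then show "\<exists>l\<in>set ys. {fst l, v} \<notin> E"
        using 2(3)[of "(u, c) # ys" zs] True by auto
    qed (use 2(2) in auto)
    moreover have "\<phi> (u, a) \<noteq> \<phi> (v, \<not> b)" for a
      using inj edge_vertices[OF True] by (auto dest: inj_onD)
    ultimately show ?thesis by simp
  next
    case False
    have "(u, c) \<noteq> (v, \<not> b)" using 2(3)[of "[]" w] by auto
    then have "\<not> label_rel E \<phi> (\<phi> (v, \<not> b)) (\<phi> (u, c))"
      using False label_rel_iff[OF assms(1) u] by (auto simp: insert_commute)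
    then show ?thesis by simp
  qed
qed simp

text \<open>The first label of a letter is fresh because the second, unrelated to it, follows at
  once; the second is fresh by \<open>fresh_expand\<close>.\<close>

lemma reduced_expand:
  assumes "w \<in> lists (V \<times> UNIV)"
    and "\<And>xs v b ys zs. w = xs @ (v, b) # ys @ (v, \<not> b) # zs \<Longrightarrow> \<exists>l\<in>set ys. {fst l, v} \<notin> E"
  shows "reduced (expand w)"
  using assms
proof (induction w rule: expand.induct)
  case (2 v b w)
  have v: "v \<in> V" and w: "w \<in> lists (V \<times> UNIV)" using 2(2) by auto
  have "{v, v} \<notin> E" using edge_vertices by blast
  then have "\<not> label_rel E \<phi> (\<phi> (v, b)) (\<phi> (v, \<not> b))"
    using label_rel_iff[OF v v] by auto
  moreover have "fresh (\<phi> (v, \<not> b)) (expand w)"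
    using 2(3)[of "[]" v b] by (intro fresh_expand v w) auto
  moreover have "reduced (expand w)"
  proof (rule "2.IH"[OF w])
    fix xs u c ys zs assume "w = xs @ (u, c) # ys @ (u, \<not> c) # zs"
    then show "\<exists>l\<in>set ys. {fst l, u} \<notin> E" using 2(3)[of "(v, b) # xs" u c ys zs] by simp
  qed
  ultimately show ?case by simp
qed simp

text \<open>Induction on length: a cancellable pair is removed without changing the action; without
  such a pair the expansion is reduced, so it acts trivially only if empty.\<close>

lemma fold_letter_act_id_imp:
  assumes "w \<in> lists (V \<times> UNIV)" "fold letter_act w = id"
  shows "raag_eq V E w []"
  using assms
proof (induction w rule: length_induct)
  case (1 w)
  show ?case
  proof (cases "\<exists>xs v b ys zs. w = xs @ (v, b) # ys @ (v, \<not> b) # zs \<and> (\<forall>l\<in>set ys. {fst l, v} \<in> E)")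
    case True
    then obtain xs v b ys zs where w: "w = xs @ (v, b) # ys @ (v, \<not> b) # zs"
      and ys: "\<And>l. l \<in> set ys \<Longrightarrow> {fst l, v} \<in> E" by blast
    have eq: "raag_eq V E w (xs @ ys @ zs)"
      unfolding w using 1(2) w ys by (intro raag_eq_cancel_past) auto
    have "fold letter_act w = fold letter_act (xs @ ys @ zs)"
      using word_act_raag_eq[OF raag_eq_rev[OF eq]]
      by (simp only: word_act_def foldr_conv_fold rev_rev_ident)
    then have "raag_eq V E (xs @ ys @ zs) []"
      using 1 w by auto
    with eq show ?thesis by (rule raag_eq_trans)
  next
    case False
    then have "reduced (expand w)"
      using 1(2) by (intro reduced_expand) blast+
    then have "expand w = []"
      using fold_swap_reduced_ne_id[OF blank, of "expand w"] expand_pos 1(3) fold_swap_expand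
      by metis
    then have "w = []" by (cases w rule: expand.cases) auto
    then show ?thesis by simp
  qed
qed

lemma word_act_id_imp:
  assumes "w \<in> lists (V \<times> UNIV)" "word_act w = id"
  shows "raag_eq V E w []"
proof -
  have "raag_eq V E (rev w) []"
    using assms by (intro fold_letter_act_id_imp) (auto simp: word_act_def foldr_conv_fold)
  from raag_eq_rev[OF this] show ?thesis by simp
qed

text \<open>The usual passage from trivial kernel to injectivity, carried out on words.\<close>

lemma word_act_eq_imp:
  assumes w: "w \<in> lists (V \<times> UNIV)" "w' \<in> lists (V \<times> UNIV)" and "word_act w = word_act w'"
  shows "raag_eq V E w w'"
proof -
  have inv: "inverse_word w' \<in> lists (V \<times> UNIV)" using w(2) by (rule inverse_word_in_lists)
  have "word_act (w @ inverse_word w') = word_act (w' @ inverse_word w')"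
    by (simp add: word_act_append assms(3))
  also have "\<dots> = id"
    using word_act_raag_eq[OF append_inverse_word_raag_eq[OF w(2)]] by simp
  finally have triv: "raag_eq V E (w @ inverse_word w') []"
    using w inv by (intro word_act_id_imp) auto
  have "raag_eq V E w (w @ inverse_word w' @ w')"
    using raag_eq_sym[OF raag_eq_context[OF inverse_word_append_raag_eq[OF w(2)], of E w "[]"]]
    by simp
  also have "raag_eq V E \<dots> w'"
    using raag_eq_context[OF triv, of "[]" w'] by simp
  finally show ?thesis .
qed

section \<open>Passage from words to group elements\<close>

definition class_act :: "('v \<times> bool) list set \<Rightarrow> (int \<Rightarrow> 'a) \<Rightarrow> (int \<Rightarrow> 'a)" where
  "class_act X = word_act (SOME w. w \<in> X)"

lemma class_act_raag_class [simp]: "class_act (raag_class V E w) = word_act w"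
proof -
  have "raag_eq V E w (SOME w'. w' \<in> raag_class V E w)"
    using someI[of "\<lambda>w'. w' \<in> raag_class V E w" w] by (simp add: raag_class_def)
  from word_act_raag_eq[OF this] show ?thesis by (simp add: class_act_def)
qed

lemma RAAG_mult_raag_class:
  "raag_class V E u \<otimes>\<^bsub>RAAG V E\<^esub> raag_class V E w = raag_class V E (u @ w)"
proof -
  have "raag_eq V E (u @ w) (u' @ w')" if "raag_eq V E u u'" "raag_eq V E w w'" for u' w'
    using raag_eq_context[OF that(1), of "[]" w] raag_eq_context[OF that(2), of u' "[]"]
    by (auto intro: raag_eq_trans)
  then show ?thesis
    unfolding RAAG_def raag_class_def by (auto intro: raag_eq_trans raag_eq_refl)
qed

lemma class_act_hom: "class_act \<in> hom (RAAG V E) topological_full_group"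
proof (rule homI)
  fix X assume "X \<in> carrier (RAAG V E)"
  then show "class_act X \<in> carrier topological_full_group"
    by (auto simp: RAAG_def topological_full_group_def word_act_in_tfg_carrier)
next
  fix X Y assume "X \<in> carrier (RAAG V E)" "Y \<in> carrier (RAAG V E)"
  then obtain u w where "X = raag_class V E u" "Y = raag_class V E w"
    by (auto simp: RAAG_def)
  then show "class_act (X \<otimes>\<^bsub>RAAG V E\<^esub> Y) = class_act X \<otimes>\<^bsub>topological_full_group\<^esub> class_act Y"
    by (simp add: RAAG_mult_raag_class topological_full_group_def word_act_append)
qed

lemma inj_on_class_act: "inj_on class_act (carrier (RAAG V E))"
proof (rule inj_onI)
  fix X Y
  assume XY: "X \<in> carrier (RAAG V E)" "Y \<in> carrier (RAAG V E)" and eq: "class_act X = class_act Y"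
  obtain u w where X: "X = raag_class V E u" "u \<in> lists (V \<times> UNIV)"
    and Y: "Y = raag_class V E w" "w \<in> lists (V \<times> UNIV)"
    using XY by (auto simp: RAAG_def)
  have "raag_eq V E u w" using X Y eq by (intro word_act_eq_imp) auto
  then show "X = Y"
    unfolding X(1) Y(1) raag_class_def by (auto intro: raag_eq_sym raag_eq_trans)
qed

end

theorem mainTheorem3:
  fixes V :: "'v set" and E :: "'v set set"
  assumes "CARD('a::finite) \<ge> 2"
    and "countable V"
    and "simple_graph V E"
  shows "\<exists>h. h \<in> hom (RAAG V E) (topological_full_group :: ((int \<Rightarrow> 'a) \<Rightarrow> (int \<Rightarrow> 'a)) monoid)
             \<and> inj_on h (carrier (RAAG V E))"
proof -
  obtain mark blank :: 'a where mb: "blank \<noteq> mark"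
    using assms(1) card_le_Suc0_iff_eq[of "UNIV :: 'a set"] by fastforce
  \<comment> \<open>An enumeration of the letters supplies the labels; adding 1 makes them positive,
    as lengths of gaps must be.\<close>
  define \<phi> :: "'v \<times> bool \<Rightarrow> int" where "\<phi> l = int (to_nat_on (V \<times> (UNIV :: bool set)) l) + 1" for l
  have "countable (V \<times> (UNIV :: bool set))" using assms(2) by simp
  from inj_on_to_nat_on[OF this] have inj: "inj_on \<phi> (V \<times> UNIV)"
    by (auto simp: inj_on_def \<phi>_def)
  interpret raag_action mark V E \<phi> blank
  proof
    fix d e show "label_rel E \<phi> d d" by (simp add: label_rel_def)
    assume "label_rel E \<phi> d e"
    then show "label_rel E \<phi> e d" unfolding label_rel_def by (metis insert_commute)
  qed (use assms(3) inj mb in \<open>auto simp: \<phi>_def\<close>)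
  show ?thesis using class_act_hom inj_on_class_act by blast
qed

end
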